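(* Let $p$ be a prime, let $\alpha_1 > \dots > \alpha_s$ and $m_1, \dots, m_s$ be positive integers ($s \geq 1$), and let $G$ be a finite abelian $p$-group with $G \cong \mathbb{Z}_{p^{\alpha_1}}^{m_1} \times \cdots \times \mathbb{Z}_{p^{\alpha_s}}^{m_s}$. For $1 \le j \le s$ put $n_j = p^{\sum_{i=1}^{j} m_i\alpha_i}$ and $r_j = \sum_{i=1}^{j} m_i$; put $r_0 = 0$, $n = n_s$ and $r = r_s$. Then the independence number of the power graph of $G$ is $$\alpha(\mathcal{P}(G)) = \sum_{t=1}^{r} \frac{n}{p^{t-1}} \left\{ \frac{p^{(r_k-1)\alpha_k}}{n_k} + \mu_k \right\},$$ where, for each $t$, the index $k = k(t) \in \{1,\dots,s\}$ is the one with $r_{k-1} < t \leq r_k$, and $$\mu_k = \begin{cases} \displaystyle\sum_{j=1}^{k-1} \frac{p^{r_j}-1}{n_j} \sum_{\beta=\alpha_{j+1}}^{\alpha_j - 1} p^{(r_j-1)\beta} & \text{if } k>1,\\ 0 & \text{if } k=1. \end{cases}$$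
   Context: The power graph $\mathcal{P}(G)$ of a group $G$ is the simple undirected graph with vertex set $G$ in which two distinct vertices are adjacent if and only if one of them is a power of the other. (For finite $p$-groups it coincides with the enhanced power graph, in which two distinct elements are adjacent when they lie in a common cyclic subgroup.) $\mathbb{Z}_n^m$ denotes the direct product of $m$ copies of the group $\mathbb{Z}_n$ of integers modulo $n$. The independence number $\alpha(\Gamma)$ of a graph $\Gamma$ is the largest cardinality of a set of pairwise non-adjacent vertices. *)

theory Defs
  imports Complex_Main "HOL-Algebra.Elementary_Groups" "HOL-Algebra.Product_Groups"
    "HOL-Computational_Algebra.Primes"
begin

text \<open>A simple undirected graph is a pair of a vertex set and a set of two-element edges.\<close>

type_synonym 'a ugraph = "'a set \<times> 'a set set"

definition power_graph :: "('a, 'b) monoid_scheme \<Rightarrow> 'a ugraph" where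
  "power_graph G =
    (carrier G,
     {{x, y} | x y. x \<in> carrier G \<and> y \<in> carrier G \<and> x \<noteq> y \<and>
        ((\<exists>k::int. y = x [^]\<^bsub>G\<^esub> k) \<or> (\<exists>k::int. x = y [^]\<^bsub>G\<^esub> k))})"

definition independent_set :: "'a ugraph \<Rightarrow> 'a set \<Rightarrow> bool" where
  "independent_set \<Gamma> S \<longleftrightarrow> S \<subseteq> fst \<Gamma> \<and> pairwise (\<lambda>x y. {x, y} \<notin> snd \<Gamma>) S"

text \<open>Only meaningful for graphs with finitely many vertices, where the maximum exists.\<close>

definition independence_number :: "'a ugraph \<Rightarrow> nat" where
  "independence_number \<Gamma> = Max (card ` {S. independent_set \<Gamma> S})"

definition cyclic_power :: "nat \<Rightarrow> nat \<Rightarrow> (nat \<Rightarrow> int) monoid" where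
  "cyclic_power n m = product_group {1..m} (\<lambda>_. integer_mod_group n)"

text \<open>
  Throughout, \<open>\<alpha>\<close> and \<open>m\<close> are sequences of which only the entries at positions
  \<open>1, \<dots>, s\<close> matter.
\<close>

definition abelian_type_group ::
  "nat \<Rightarrow> nat \<Rightarrow> (nat \<Rightarrow> nat) \<Rightarrow> (nat \<Rightarrow> nat) \<Rightarrow> (nat \<Rightarrow> nat \<Rightarrow> int) monoid" where
  "abelian_type_group p s \<alpha> m = product_group {1..s} (\<lambda>i. cyclic_power (p ^ \<alpha> i) (m i))"

definition partial_size :: "nat \<Rightarrow> (nat \<Rightarrow> nat) \<Rightarrow> (nat \<Rightarrow> nat) \<Rightarrow> nat \<Rightarrow> nat" where
  "partial_size p \<alpha> m j = p ^ (\<Sum>i=1..j. m i * \<alpha> i)"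

definition partial_rank :: "(nat \<Rightarrow> nat) \<Rightarrow> nat \<Rightarrow> nat" where
  "partial_rank m j = (\<Sum>i=1..j. m i)"

definition block_index :: "nat \<Rightarrow> (nat \<Rightarrow> nat) \<Rightarrow> nat \<Rightarrow> nat" where
  "block_index s m t =
    (THE k. k \<in> {1..s} \<and> partial_rank m (k - 1) < t \<and> t \<le> partial_rank m k)"

text \<open>
  The natural-number subtractions below do not truncate when all \<open>m i\<close> and
  \<open>\<alpha> i\<close> are positive.
\<close>

definition correction_term ::
  "nat \<Rightarrow> (nat \<Rightarrow> nat) \<Rightarrow> (nat \<Rightarrow> nat) \<Rightarrow> nat \<Rightarrow> real" where
  "correction_term p \<alpha> m k =
    (if k > 1 then
       (\<Sum>j=1..k-1.
          (real p ^ partial_rank m j - 1) / real (partial_size p \<alpha> m j) *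
          (\<Sum>\<beta>=\<alpha> (j+1)..\<alpha> j - 1. real p ^ ((partial_rank m j - 1) * \<beta>)))
     else 0)"

end

theory Submission
  imports Defs "HOL-Algebra.Multiplicative_Group" "HOL-Number_Theory.Totient"
begin

text \<open>
  The cyclic subgroups of a \<open>p\<close>-group form a forest under inclusion, so the independence number
  of the power graph is the number of maximal cyclic subgroups, and these are the subgroups
  generated by elements that are not \<open>p\<close>-th powers. Write \<open>N b\<close> for the number of \<open>x\<close> with
  \<open>x\<^sup>q = 1\<close>, \<open>q = p ^ b\<close>. Since \<open>x \<mapsto> x\<^sup>p\<close> maps the \<open>p ^ (b + 1)\<close>-torsion onto the \<open>p\<close>-th powers in
  the \<open>p ^ b\<close>-torsion with kernel of size \<open>N 1\<close>, the number of maximal cyclic subgroups of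
  order \<open>p ^ (b + 1)\<close> is
  \<open>((N (b + 1) - N b) - (N (b + 2) - N (b + 1)) / N 1) / (p ^ b * (p - 1))\<close>.
  For the given type, \<open>N b = p ^ (\<Sum>i. m i * min (\<alpha> i) b)\<close>, and both this count and the claimed
  formula telescope to the same sum when expressed through the ratios \<open>N b / p ^ b\<close>.
\<close>

section \<open>Torsion in products of cyclic groups\<close>

text \<open>Fibre counting, used both for the \<open>p\<close>-th power map on torsion and for the
  map sending an element to the cyclic subgroup it generates.\<close>

lemma card_eq_mult_card_image:
  assumes "finite A" and "\<And>x. x \<in> A \<Longrightarrow> card {y \<in> A. f y = f x} = c"
  shows "card A = c * card (f ` A)"
proof -
  have "card A = (\<Sum>z\<in>f ` A. card {y \<in> A. f y = z})"
    using sum.image_gen[OF assms(1), of "\<lambda>_. 1::nat" f] by simp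
  also have "\<dots> = (\<Sum>z\<in>f ` A. c)"
    using assms(2) by (intro sum.cong) auto
  finally show ?thesis by simp
qed

definition power_torsion :: "('a, 'b) monoid_scheme \<Rightarrow> nat \<Rightarrow> 'a set" where
  "power_torsion G q = {x \<in> carrier G. x [^]\<^bsub>G\<^esub> q = \<one>\<^bsub>G\<^esub>}"

lemma nat_pow_product_group:
  assumes "x \<in> carrier (product_group I F)" "\<And>i. i \<in> I \<Longrightarrow> group (F i)"
  shows "x [^]\<^bsub>product_group I F\<^esub> (n::nat) = (\<lambda>i\<in>I. x i [^]\<^bsub>F i\<^esub> n)"
proof (induction n)
  case 0
  then show ?case by (simp add: nat_pow_def)
next
  case (Suc n)
  have "x [^]\<^bsub>product_group I F\<^esub> Suc n
      = x [^]\<^bsub>product_group I F\<^esub> n \<otimes>\<^bsub>product_group I F\<^esub> x"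
    by (simp add: nat_pow_def)
  also have "\<dots> = (\<lambda>i\<in>I. x i [^]\<^bsub>F i\<^esub> Suc n)"
    unfolding Suc.IH by (auto simp: nat_pow_def)
  finally show ?case .
qed

lemma power_torsion_product_group:
  assumes "\<And>i. i \<in> I \<Longrightarrow> group (F i)"
  shows "power_torsion (product_group I F) q = (\<Pi>\<^sub>E i\<in>I. power_torsion (F i) q)"
proof -
  have "x [^]\<^bsub>product_group I F\<^esub> q = \<one>\<^bsub>product_group I F\<^esub> \<longleftrightarrow>
      (\<forall>i\<in>I. x i [^]\<^bsub>F i\<^esub> q = \<one>\<^bsub>F i\<^esub>)" if "x \<in> carrier (product_group I F)" for x
    by (subst nat_pow_product_group[OF that assms]) (auto simp: fun_eq_iff restrict_def)
  then have "x \<in> power_torsion (product_group I F) q \<longleftrightarrow> x \<in> (\<Pi>\<^sub>E i\<in>I. power_torsion (F i) q)"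
    for x
    unfolding power_torsion_def mem_Collect_eq PiE_iff carrier_product_group by blast
  then show ?thesis by blast
qed

lemma card_power_torsion_product_group:
  assumes "\<And>i. i \<in> I \<Longrightarrow> group (F i)" "finite I"
  shows "card (power_torsion (product_group I F) q) = (\<Prod>i\<in>I. card (power_torsion (F i) q))"
  using assms by (simp add: power_torsion_product_group card_PiE)

text \<open>A residue is killed by \<open>p ^ b\<close> exactly when
  \<open>p ^ (a - min a b)\<close> divides it, and \<open>{0..<p ^ a}\<close> contains
  \<open>p ^ min a b\<close> such multiples.\<close>

lemma card_power_torsion_integer_mod_group:
  assumes "prime p"
  shows "card (power_torsion (integer_mod_group (p ^ a)) (p ^ b)) = p ^ min a b"
proof -
  have p: "p > 0" using assms by (simp add: prime_gt_0_nat)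
  define d where "d = a - min a b"
  have a: "a = d + min a b" by (simp add: d_def)
  have dvd: "int (p ^ a) dvd int (p ^ b) * x \<longleftrightarrow> int (p ^ d) dvd x" for x
  proof (cases "b \<le> a")
    case True
    then have "int (p ^ a) = int (p ^ b) * int (p ^ d)"
      by (simp add: d_def flip: power_add of_nat_mult)
    then show ?thesis using p by simp
  next
    case False
    then have "int (p ^ a) dvd int (p ^ b)" "d = 0"
      by (simp_all add: d_def le_imp_power_dvd)
    then show ?thesis by simp
  qed
  have "power_torsion (integer_mod_group (p ^ a)) (p ^ b)
      = {x \<in> {0..<int (p ^ a)}. int (p ^ d) dvd x}"
    using p dvd by (auto simp: power_torsion_def carrier_integer_mod_group dvd_eq_mod_eq_0)
  also have "\<dots> = (\<lambda>x. int (p ^ d) * x) ` {0..<int (p ^ min a b)}"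
  proof -
    have eq: "int (p ^ a) = int (p ^ d) * int (p ^ min a b)"
      by (subst a) (simp add: power_add)
    have scale: "D * x \<in> {0..<D * M} \<longleftrightarrow> x \<in> {0..<M}" if "D > 0" for D M x :: int
      using that by (auto simp: zero_le_mult_iff)
    have "int (p ^ d) * x \<in> {0..<int (p ^ a)} \<longleftrightarrow> x \<in> {0..<int (p ^ min a b)}" for x
      unfolding eq using p by (intro scale) simp
    then show ?thesis unfolding dvd_def image_def by blast
  qed
  also have "card \<dots> = p ^ min a b"
    using p by (subst card_image) (auto intro!: inj_onI simp: nat_power_eq)
  finally show ?thesis .
qed

lemma card_power_torsion_abelian_type_group:
  assumes "prime p"
  shows "card (power_torsion (abelian_type_group p s \<alpha> m) (p ^ b))
    = p ^ (\<Sum>i=1..s. m i * min (\<alpha> i) b)"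
  by (simp add: abelian_type_group_def cyclic_power_def card_power_torsion_product_group
      card_power_torsion_integer_mod_group[OF assms] power_sum mult.commute flip: power_mult)

lemma card_power_torsion_iso:
  assumes "G \<cong> H" "group G" "group H"
  shows "card (power_torsion G q) = card (power_torsion H q)"
proof -
  obtain h where h: "h \<in> iso G H" using assms(1) by (auto simp: is_iso_def)
  then have hom: "group_hom G H h"
    using assms by (simp add: group_hom_def group_hom_axioms_def iso_def)
  have bij: "bij_betw h (carrier G) (carrier H)" using h by (simp add: iso_def)
  have "h x [^]\<^bsub>H\<^esub> q = \<one>\<^bsub>H\<^esub> \<longleftrightarrow> x [^]\<^bsub>G\<^esub> q = \<one>\<^bsub>G\<^esub>" if "x \<in> carrier G" for x
  proof -
    have "h x [^]\<^bsub>H\<^esub> q = h (x [^]\<^bsub>G\<^esub> q)"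
      using group_hom.hom_nat_pow[OF hom that] by simp
    moreover have "h (x [^]\<^bsub>G\<^esub> q) = h \<one>\<^bsub>G\<^esub> \<longleftrightarrow> x [^]\<^bsub>G\<^esub> q = \<one>\<^bsub>G\<^esub>"
      using bij that assms(2)
      by (intro inj_on_eq_iff[of h "carrier G"])
        (auto simp: bij_betw_def monoid.nat_pow_closed group.is_monoid)
    ultimately show ?thesis using group_hom.hom_one[OF hom] by simp
  qed
  then have "power_torsion H q = h ` power_torsion G q"
    using bij by (fastforce simp: power_torsion_def bij_betw_def)
  moreover have "inj_on h (power_torsion G q)"
    using bij by (auto simp: power_torsion_def bij_betw_def intro: inj_on_subset)
  ultimately show ?thesis by (simp add: card_image)
qed

section \<open>Maximal cyclic subgroups\<close>

locale finite_abelian_p_group = comm_group G for G (structure) +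
  fixes p e :: nat
  assumes prime_p: "prime p" and order_eq: "order G = p ^ e"
begin

section \<open>Cyclic subgroups of a finite abelian \<open>p\<close>-group\<close>

lemma finite_carrier: "finite (carrier G)"
  using order_eq prime_gt_0_nat[OF prime_p] by (simp flip: order_gt_0_iff_finite)

definition pth_powers :: "'a set" where
  "pth_powers = (\<lambda>x. x [^] p) ` carrier G"

lemma ord_pos: "x \<in> carrier G \<Longrightarrow> ord x > 0"
  using ord_ge_1[OF finite_carrier] by fastforce

lemma ord_prime_power:
  assumes "x \<in> carrier G"
  obtains i where "ord x = p ^ i"
  using ord_dvd_group_order[OF assms] prime_p order_eq by (auto simp: divides_primepow_nat)

lemma mem_generate_iff:
  "x \<in> carrier G \<Longrightarrow> y \<in> generate G {x} \<longleftrightarrow> (\<exists>k::nat. y = x [^] k)"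
  using ord_pos by (subst generate_pow_nat) auto

lemma generate_carrier: "x \<in> carrier G \<Longrightarrow> generate G {x} \<subseteq> carrier G"
  by (simp add: generate_incl)

lemma generate_mono_mem:
  assumes "x \<in> carrier G" "y \<in> generate G {x}"
  shows "generate G {y} \<subseteq> generate G {x}"
  using assms by (intro generate_subgroup_incl) (auto intro: generate_is_subgroup)

lemma generate_eqI:
  assumes "x \<in> carrier G" "y \<in> generate G {x}" "ord y = ord x"
  shows "generate G {y} = generate G {x}"
proof (rule card_subset_eq)
  show "finite (generate G {x})"
    using finite_subset[OF generate_carrier[OF assms(1)] finite_carrier] .
  have "y \<in> carrier G" using assms generate_carrier by blast
  then show "card (generate G {y}) = card (generate G {x})"
    using assms by (simp flip: generate_pow_card)
qed (use assms generate_mono_mem in blast)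

text \<open>The gcd divides \<open>k\<close>, which gives one inclusion; both powers have order
  \<open>ord x / gcd (ord x) k\<close>, so equality follows by size.\<close>

lemma generate_pow_gcd:
  assumes "x \<in> carrier G"
  shows "generate G {x [^] k} = generate G {x [^] gcd (ord x) k}"
proof (rule generate_eqI)
  have "gcd (ord x) k dvd k" by simp
  then obtain l where "k = gcd (ord x) k * l" by (elim dvdE)
  then have "x [^] k = (x [^] gcd (ord x) k) [^] l"
    using assms by (simp add: nat_pow_pow)
  then show "x [^] k \<in> generate G {x [^] gcd (ord x) k}"
    using assms by (subst mem_generate_iff) auto
  show "ord (x [^] k) = ord (x [^] gcd (ord x) k)"
    using assms ord_pos[OF assms] by (auto simp: ord_pow_gen)
qed (use assms in simp)

text \<open>The forest property. Up to the choice of generator every power of \<open>z\<close> has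
  an exponent \<open>p ^ u\<close>, and the subgroups generated by these powers form a chain in
  \<open>u\<close>.\<close>

lemma generate_comparable:
  assumes "z \<in> carrier G" "x \<in> generate G {z}" "y \<in> generate G {z}"
  shows "x \<in> generate G {y} \<or> y \<in> generate G {x}"
proof -
  obtain a b where ab: "x = z [^] (a::nat)" "y = z [^] (b::nat)"
    using assms mem_generate_iff by metis
  obtain i where i: "ord z = p ^ i" using ord_prime_power assms(1) by blast
  obtain u where u: "gcd (ord z) a = p ^ u"
    using divides_primepow_nat[OF prime_p, of "gcd (ord z) a" i] i by auto
  obtain v where v: "gcd (ord z) b = p ^ v"
    using divides_primepow_nat[OF prime_p, of "gcd (ord z) b" i] i by auto
  have mono: "generate G {z [^] (p ^ v)} \<subseteq> generate G {z [^] (p ^ u)}" if "u \<le> v" for u v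
  proof (rule generate_mono_mem)
    have "z [^] (p ^ v) = (z [^] (p ^ u)) [^] (p ^ (v - u))"
      using assms(1) that by (simp add: nat_pow_pow flip: power_add)
    then show "z [^] (p ^ v) \<in> generate G {z [^] (p ^ u)}"
      using assms(1) by (subst mem_generate_iff) auto
  qed (use assms in simp)
  have "generate G {x} \<subseteq> generate G {y} \<or> generate G {y} \<subseteq> generate G {x}"
    using mono[of u v] mono[of v u] generate_pow_gcd[OF assms(1)]
    unfolding ab u[symmetric] v[symmetric] by (metis nat_le_linear u v)
  then show ?thesis using generate.incl[of _ "{_}" G] by blast
qed

text \<open>Writing \<open>x\<close> as the \<open>k\<close>-th power of \<open>y\<close>, a factor
  \<open>p\<close> of \<open>k\<close> would make \<open>x\<close> a \<open>p\<close>-th power. So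
  \<open>k\<close> is coprime to the \<open>p\<close>-power \<open>ord y\<close>. Hence elements
  outside \<open>pth_powers\<close> generate maximal cyclic subgroups.\<close>

lemma generate_eq_of_not_pth_power:
  assumes "x \<notin> pth_powers" "y \<in> carrier G" "x \<in> generate G {y}"
  shows "generate G {x} = generate G {y}"
proof -
  obtain k where k: "x = y [^] (k::nat)" using assms mem_generate_iff by auto
  have "\<not> p dvd k"
  proof
    assume "p dvd k"
    then obtain l where "k = p * l" by (elim dvdE)
    then have "x = (y [^] l) [^] p" using k assms(2) by (simp add: nat_pow_pow mult.commute)
    then show False using assms by (auto simp: pth_powers_def)
  qed
  then have "coprime (ord y) k"
    using prime_p ord_prime_power[OF assms(2)]
    by (metis coprime_power_left_iff prime_imp_coprime)
  then show ?thesis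
    using generate_pow_gcd[OF assms(2), of k] assms(2) k by (simp add: coprime_iff_gcd_eq_1)
qed

text \<open>Among all \<open>y\<close> whose cyclic subgroup contains \<open>x\<close>, one of
  greatest order is not a \<open>p\<close>-th power: a \<open>p\<close>-th root of it would have
  larger order and still cover \<open>x\<close>.\<close>

lemma ex_not_pth_power_generator:
  assumes "x \<in> carrier G" "e > 0"
  shows "\<exists>y\<in>carrier G - pth_powers. x \<in> generate G {y}"
proof -
  have nontriv: "\<exists>y\<in>carrier G - pth_powers. x \<in> generate G {y}"
    if x: "x \<in> carrier G" "x \<noteq> \<one>" for x
  proof -
    let ?P = "\<lambda>y. y \<in> carrier G \<and> x \<in> generate G {y}"
    have "?P x" using x generate.incl[of x "{x}" G] by simp
    moreover have "\<forall>y. ?P y \<longrightarrow> ord y < Suc (order G)"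
      using ord_le_group_order[OF finite_carrier] by (simp add: less_Suc_eq_le)
    ultimately have "\<exists>y. ?P y \<and> (\<forall>z. ?P z \<longrightarrow> ord z \<le> ord y)"
      by (rule ex_has_greatest_nat)
    then obtain y where y: "?P y" and max: "\<And>z. ?P z \<Longrightarrow> ord z \<le> ord y" by blast
    have "y \<notin> pth_powers"
    proof
      assume "y \<in> pth_powers"
      then obtain z where z: "z \<in> carrier G" "y = z [^] p" by (auto simp: pth_powers_def)
      then have "y \<in> generate G {z}" by (auto simp: mem_generate_iff)
      then have "ord z \<le> ord y" using max y z generate_mono_mem by blast
      \<comment> \<open>Taking the \<open>p\<close>-th power divides the order by \<open>p\<close>
        only for a nontrivial element; this is where \<open>x \<noteq> \<one>\<close>
        enters.\<close>
      moreover have "ord y \<noteq> 1"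
      proof
        assume "ord y = 1"
        then have "y = \<one>" using y ord_eq_1 by blast
        then show False using x(2) y mem_generate_iff[of \<one> x] by auto
      qed
      obtain i where i: "ord z = p ^ i" using ord_prime_power z(1) by blast
      have "i \<noteq> 0"
        using \<open>ord y \<noteq> 1\<close> z i ord_eq_1[of z] ord_eq_1[of y] by auto
      then have "ord y = ord z div p"
        using ord_pow[OF z(1), of p] z(2) i prime_p by (simp add: prime_gt_0_nat dvd_power)
      moreover have "ord z div p < ord z"
        using prime_gt_1_nat[OF prime_p] ord_pos[OF z(1)] by simp
      ultimately show False by simp
    qed
    then show ?thesis using y by blast
  qed
  show ?thesis
  proof (cases "x = \<one>")
    case True
    \<comment> \<open>Every cyclic subgroup contains the unit, so covering any nontrivial
      \<open>w\<close> suffices; \<open>e > 0\<close> supplies one.\<close>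
    have "1 < card (carrier G)"
      using order_eq one_less_power[OF prime_gt_1_nat[OF prime_p] assms(2)] by (simp add: order_def)
    then have "carrier G \<noteq> {\<one>}" by auto
    then obtain w where "w \<in> carrier G" "w \<noteq> \<one>" using one_closed by blast
    then show ?thesis using nontriv[of w] True generate.one by blast
  next
    case False
    then show ?thesis using nontriv assms by blast
  qed
qed

lemma one_mem_pth_powers: "\<one> \<in> pth_powers"
  unfolding pth_powers_def by (rule image_eqI[of _ _ \<one>]) auto

text \<open>Exponents commute, so a power of a \<open>p\<close>-th power is one too. Consequently
  all generators of a cyclic subgroup lie in \<open>pth_powers\<close> or none does.\<close>

lemma pth_powers_generate:
  assumes "x \<in> pth_powers" "y \<in> generate G {x}"
  shows "y \<in> pth_powers"
proof -
  obtain z where z: "z \<in> carrier G" "x = z [^] p" using assms by (auto simp: pth_powers_def)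
  then obtain k where "y = x [^] (k::nat)" using assms mem_generate_iff by auto
  then have "y = (z [^] k) [^] p" using z by (simp add: nat_pow_pow mult.commute)
  then show ?thesis using z by (auto simp: pth_powers_def)
qed

section \<open>Independent sets of the power graph\<close>

lemma adjacent_iff:
  assumes "x \<in> carrier G" "y \<in> carrier G"
  shows "{x, y} \<in> snd (power_graph G) \<longleftrightarrow>
    x \<noteq> y \<and> (y \<in> generate G {x} \<or> x \<in> generate G {y})"
  using assms unfolding power_graph_def by (auto simp: doubleton_eq_iff generate_pow)

text \<open>Each vertex is sent to a maximal cyclic subgroup containing it. Two vertices with the
  same image are comparable, so the map is injective on independent sets; this is the upper
  bound.\<close>

lemma independence_number_eq:
  assumes "e > 0"
  shows "independence_number (power_graph G)
    = card ((\<lambda>x. generate G {x}) ` (carrier G - pth_powers))" (is "_ = card ?M")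
  unfolding independence_number_def
proof (rule Max_eqI)
  have "{S. independent_set (power_graph G) S} \<subseteq> Pow (carrier G)"
    by (auto simp: independent_set_def power_graph_def)
  then show "finite (card ` {S. independent_set (power_graph G) S})"
    using finite_carrier by (meson finite_Pow_iff finite_imageI finite_subset)
next
  have fin: "finite ?M" using finite_carrier by simp
  fix c assume "c \<in> card ` {S. independent_set (power_graph G) S}"
  then obtain S where S: "independent_set (power_graph G) S" and c: "c = card S" by auto
  have sub: "S \<subseteq> carrier G" using S by (simp add: independent_set_def power_graph_def)
  have "\<forall>x\<in>S. \<exists>y. y \<in> carrier G - pth_powers \<and> x \<in> generate G {y}"
    using sub ex_not_pth_power_generator[OF _ assms] by blast
  then obtain f where f: "\<And>x. x \<in> S \<Longrightarrow> f x \<in> carrier G - pth_powers"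
    "\<And>x. x \<in> S \<Longrightarrow> x \<in> generate G {f x}" by metis
  have "inj_on (\<lambda>x. generate G {f x}) S"
  proof (rule inj_onI, rule ccontr)
    fix x y assume xy: "x \<in> S" "y \<in> S" "generate G {f x} = generate G {f y}" "x \<noteq> y"
    then have "x \<in> generate G {y} \<or> y \<in> generate G {x}"
      using f[of x] f[of y] generate_comparable[of "f x" x y] by auto
    then have "{x, y} \<in> snd (power_graph G)"
      using xy sub adjacent_iff[of x y] by blast
    then show False
      using S xy by (auto simp: independent_set_def pairwise_def)
  qed
  then show "c \<le> card ?M"
    unfolding c using f(1) fin by (intro card_inj_on_le[of "\<lambda>x. generate G {f x}"]) auto
next
  \<comment> \<open>The bound is attained by choosing one generator of each maximal cyclic
    subgroup.\<close>
  obtain S where S: "S \<subseteq> carrier G - pth_powers" "inj_on (\<lambda>x. generate G {x}) S"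
    "?M = (\<lambda>x. generate G {x}) ` S"
    using subset_image_inj[of ?M "\<lambda>x. generate G {x}" "carrier G - pth_powers"] by auto
  have "{x, y} \<notin> snd (power_graph G)" if xy: "x \<in> S" "y \<in> S" "x \<noteq> y" for x y
  proof
    assume "{x, y} \<in> snd (power_graph G)"
    then have "generate G {x} = generate G {y}"
      using xy S(1) adjacent_iff[of x y] generate_eq_of_not_pth_power[of x y]
        generate_eq_of_not_pth_power[of y x] by auto
    then show False using xy S(2) by (auto dest: inj_onD)
  qed
  then have "independent_set (power_graph G) S"
    using S(1) by (auto simp: independent_set_def power_graph_def pairwise_def)
  moreover have "card ?M = card S" using S by (simp add: card_image)
  ultimately show "card ?M \<in> card ` {S. independent_set (power_graph G) S}" by blast
qed

text \<open>The generators of the subgroup are the powers of \<open>y\<close> with exponent coprime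
  to \<open>ord y\<close>. None of them is a \<open>p\<close>-th power, because \<open>y\<close>
  would then be one as well.\<close>

lemma card_generators:
  assumes "y \<in> carrier G - pth_powers"
  shows "card {x \<in> carrier G - pth_powers. generate G {x} = generate G {y}} = totient (ord y)"
proof -
  have y: "y \<in> carrier G" using assms by simp
  have "{x \<in> carrier G - pth_powers. generate G {x} = generate G {y}}
      = (\<lambda>k. y [^] k) ` totatives (ord y)"
  proof (intro equalityI subsetI)
    fix x assume x: "x \<in> {x \<in> carrier G - pth_powers. generate G {x} = generate G {y}}"
    then have "x \<in> generate G {y}" using generate.incl[of x "{x}" G] by auto
    then obtain k where k: "x = y [^] (k::nat)" using mem_generate_iff[OF y] by auto
    define l where "l = k mod ord y"
    have "ord x = ord y" using x y by (simp add: generate_pow_card)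
    then have "coprime k (ord y)"
      using k pow_ord_eq_ord_iff[OF finite_carrier y] by simp
    then have l: "coprime l (ord y)"
      using ord_pos[OF y] by (simp add: l_def coprime_mod_left_iff)
    \<comment> \<open>Totatives are positive, so the residue \<open>l = 0\<close> has to be
      excluded. It is coprime only to \<open>1\<close>, and order \<open>1\<close> would make
      \<open>y\<close> the unit, which is a \<open>p\<close>-th power.\<close>
    moreover have "ord y \<noteq> 1"
      using assms one_mem_pth_powers y ord_eq_1 by auto
    then have "0 < l" using l by (cases "l = 0") auto
    moreover have "l \<le> ord y"
      using ord_pos[OF y] by (simp add: l_def less_imp_le)
    moreover have "x = y [^] l"
    proof -
      have "y [^] k = y [^] (ord y * (k div ord y)) \<otimes> y [^] l"
        using y by (simp add: l_def nat_pow_mult)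
      then show ?thesis using k y by (simp flip: nat_pow_pow)
    qed
    ultimately show "x \<in> (\<lambda>k. y [^] k) ` totatives (ord y)"
      by (auto simp: totatives_def)
  next
    fix x assume "x \<in> (\<lambda>k. y [^] k) ` totatives (ord y)"
    then obtain k where k: "x = y [^] k" "coprime k (ord y)" by (auto simp: totatives_def)
    then have eq: "generate G {x} = generate G {y}"
      using generate_pow_gcd[OF y, of k] y by (simp add: coprime_iff_gcd_eq_1 gcd.commute)
    moreover have "x \<notin> pth_powers"
      using assms generate.incl[of y "{y}" G] eq pth_powers_generate by auto
    ultimately show "x \<in> {x \<in> carrier G - pth_powers. generate G {x} = generate G {y}}"
      using k y by simp
  qed
  moreover have "inj_on (\<lambda>k. y [^] k) (totatives (ord y))"
    using ord_inj'[OF y] by (rule inj_on_subset) (auto simp: totatives_def)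
  ultimately show ?thesis by (simp add: card_image totient_def)
qed

section \<open>Counting maximal cyclic subgroups by order\<close>

abbreviation torsion_card :: "nat \<Rightarrow> nat" where
  "torsion_card b \<equiv> card (power_torsion G (p ^ b))"

lemma finite_power_torsion: "finite (power_torsion G q)"
  using finite_carrier by (simp add: power_torsion_def)

lemma mem_power_torsion_iff:
  "x \<in> power_torsion G q \<longleftrightarrow> x \<in> carrier G \<and> ord x dvd q"
  by (auto simp: power_torsion_def pow_eq_id)

lemma power_torsion_Suc: "power_torsion G (p ^ b) \<subseteq> power_torsion G (p ^ Suc b)"
  by (auto simp: mem_power_torsion_iff)

text \<open>The fibre of the \<open>p\<close>-th power map through \<open>x\<close> is the coset of
  the \<open>p\<close>-torsion by \<open>x\<close>; commutativity makes the quotient of two members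
  of a fibre a \<open>p\<close>-torsion element.\<close>

lemma torsion_card_Suc_eq:
  "torsion_card (Suc b) = torsion_card 1 * card (pth_powers \<inter> power_torsion G (p ^ b))"
proof -
  let ?T = "power_torsion G (p ^ Suc b)"
  have "(\<lambda>x. x [^] p) ` ?T = pth_powers \<inter> power_torsion G (p ^ b)"
    by (auto simp: power_torsion_def pth_powers_def nat_pow_pow)
  moreover have "card {y \<in> ?T. y [^] p = x [^] p} = torsion_card 1" if x: "x \<in> ?T" for x
  proof -
    have xc: "x \<in> carrier G" using x by (simp add: power_torsion_def)
    have "{y \<in> ?T. y [^] p = x [^] p} = (\<lambda>z. x \<otimes> z) ` power_torsion G p"
    proof (intro equalityI subsetI)
      fix y assume y: "y \<in> {y \<in> ?T. y [^] p = x [^] p}"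
      then have yc: "y \<in> carrier G" by (simp add: power_torsion_def)
      have "(inv x \<otimes> y) [^] p = \<one>"
        using y yc xc by (simp add: pow_mult_distrib m_comm nat_pow_inv)
      then have "inv x \<otimes> y \<in> power_torsion G p"
        using xc yc by (simp add: power_torsion_def)
      moreover have "y = x \<otimes> (inv x \<otimes> y)" using xc yc by (simp flip: m_assoc)
      ultimately show "y \<in> (\<lambda>z. x \<otimes> z) ` power_torsion G p" by blast
    next
      fix y assume "y \<in> (\<lambda>z. x \<otimes> z) ` power_torsion G p"
      then obtain z where z: "z \<in> carrier G" "z [^] p = \<one>" "y = x \<otimes> z"
        by (auto simp: power_torsion_def)
      then have yp: "y [^] p = x [^] p" using xc by (simp add: pow_mult_distrib m_comm)
      have "w [^] (p ^ Suc b) = (w [^] p) [^] (p ^ b)" if "w \<in> carrier G" for w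
        using that by (simp add: nat_pow_pow)
      then have "y \<in> ?T" using x xc yp z by (simp add: power_torsion_def)
      then show "y \<in> {y \<in> ?T. y [^] p = x [^] p}" using yp by simp
    qed
    moreover have "inj_on (\<lambda>z. x \<otimes> z) (power_torsion G p)"
      using xc by (auto simp: inj_on_def power_torsion_def)
    ultimately show ?thesis by (simp add: card_image)
  qed
  ultimately show ?thesis
    using card_eq_mult_card_image[OF finite_power_torsion, of "p ^ Suc b" "\<lambda>x. x [^] p"] by simp
qed

lemma torsion_card_pos: "torsion_card b > 0"
proof -
  have "\<one> \<in> power_torsion G (p ^ b)" by (simp add: power_torsion_def)
  then show ?thesis using finite_power_torsion card_gt_0_iff by blast
qed

definition maximal_cyclic_of_order :: "nat \<Rightarrow> 'a set set" where
  "maximal_cyclic_of_order q = (\<lambda>x. generate G {x}) ` {x \<in> carrier G - pth_powers. ord x = q}"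

text \<open>Elements of order \<open>p ^ Suc b\<close> outside \<open>pth_powers\<close> are counted
  by inclusion of torsion subgroups, then divided by the totient \<open>p ^ b * (p - 1)\<close>, the
  number of generators of each subgroup.\<close>

lemma card_maximal_cyclic_of_order:
  "real (card (maximal_cyclic_of_order (p ^ Suc b))) =
    ((real (torsion_card (Suc b)) - real (torsion_card b))
      - (real (torsion_card (Suc (Suc b))) - real (torsion_card (Suc b))) / real (torsion_card 1))
    / (real p ^ b * (real p - 1))"
proof -
  let ?X = "{x \<in> carrier G - pth_powers. ord x = p ^ Suc b}"
  let ?T = "\<lambda>b. power_torsion G (p ^ b)"
  let ?M = "\<lambda>b. pth_powers \<inter> ?T b"
  have p: "p > 1" using prime_p prime_gt_1_nat by blast
  have "card {y \<in> ?X. generate G {y} = generate G {x}} = totient (p ^ Suc b)" if "x \<in> ?X" for x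
  proof -
    have "{y \<in> ?X. generate G {y} = generate G {x}}
        = {y \<in> carrier G - pth_powers. generate G {y} = generate G {x}}"
      using that by (auto simp: generate_pow_card)
    then show ?thesis using that card_generators[of x] by simp
  qed
  then have "card ?X = totient (p ^ Suc b) * card (maximal_cyclic_of_order (p ^ Suc b))"
    unfolding maximal_cyclic_of_order_def
    using finite_carrier by (intro card_eq_mult_card_image) auto
  then have 1: "real (card ?X) = real p ^ b * (real p - 1)
      * real (card (maximal_cyclic_of_order (p ^ Suc b)))"
    using p by (simp add: totient_prime_power_Suc[OF prime_p] of_nat_diff del: power_Suc)
  have "ord x = p ^ Suc b \<longleftrightarrow> x \<in> ?T (Suc b) \<and> x \<notin> ?T b" if "x \<in> carrier G" for x
  proof -
    obtain i where "ord x = p ^ i" using ord_prime_power \<open>x \<in> carrier G\<close> by blast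
    then show ?thesis
      using p that by (auto simp: mem_power_torsion_iff dvd_power_iff_le power_inject_exp
          simp del: power_Suc)
  qed
  then have X: "?X = (?T (Suc b) - ?M (Suc b)) - (?T b - ?M b)"
    by (auto simp: power_torsion_def)
  have card_diff: "real (card (A - B)) = real (card A) - real (card B)"
    if "B \<subseteq> A" "finite A" for A B :: "'a set"
    using that by (simp add: card_Diff_subset card_mono finite_subset of_nat_diff)
  have "real (card ?X) = real (card (?T (Suc b) - ?M (Suc b))) - real (card (?T b - ?M b))"
    unfolding X using power_torsion_Suc[of b] finite_power_torsion by (intro card_diff) auto
  also have "\<dots> = (real (torsion_card (Suc b)) - real (card (?M (Suc b))))
      - (real (torsion_card b) - real (card (?M b)))"
  proof -
    have "real (card (?T c - ?M c)) = real (torsion_card c) - real (card (?M c))" for c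
      using finite_power_torsion by (intro card_diff) auto
    then show ?thesis by presburger
  qed
  also have "\<dots> = (real (torsion_card (Suc b)) - real (torsion_card b))
      - (real (torsion_card (Suc (Suc b))) - real (torsion_card (Suc b))) / real (torsion_card 1)"
  proof -
    \<comment> \<open>The fibre count one level up: the \<open>p\<close>-th powers in the
      \<open>p ^ c\<close>-torsion are the image of the \<open>p ^ Suc c\<close>-torsion.\<close>
    have "real (card (?M c)) = real (torsion_card (Suc c)) / real (torsion_card 1)" for c
      using torsion_card_Suc_eq[of c] torsion_card_pos[of 1] by simp
    then show ?thesis by (simp add: diff_divide_distrib del: power_Suc)
  qed
  finally show ?thesis using 1 p by (simp add: field_simps)
qed

text \<open>The maximal cyclic subgroups are sorted by their order, which ranges over
  \<open>p ^ 1\<close> to \<open>p ^ a\<close>; order \<open>1\<close> does not occur since the unit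
  is a \<open>p\<close>-th power.\<close>

lemma independence_number_eq_sum:
  assumes "e > 0" and "power_torsion G (p ^ a) = carrier G"
  shows "real (independence_number (power_graph G)) =
    (\<Sum>b<a. ((real (torsion_card (Suc b)) - real (torsion_card b))
      - (real (torsion_card (Suc (Suc b))) - real (torsion_card (Suc b))) / real (torsion_card 1))
    / (real p ^ b * (real p - 1)))"
proof -
  have p: "p > 1" using prime_p prime_gt_1_nat by blast
  have ord: "\<exists>b<a. ord x = p ^ Suc b" if x: "x \<in> carrier G - pth_powers" for x
  proof -
    obtain i where i: "ord x = p ^ i" using ord_prime_power x by blast
    have "i \<noteq> 0"
    proof
      assume "i = 0"
      then have "x = \<one>" using i x ord_eq_1[of x] by simp
      then show False using x one_mem_pth_powers by simp
    qed
    moreover have "p ^ i dvd p ^ a" using assms(2) x i by (metis DiffD1 mem_power_torsion_iff)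
    then have "i \<le> a" using p by (simp add: dvd_power_iff_le)
    ultimately have "i - 1 < a" "ord x = p ^ Suc (i - 1)" using i by auto
    then show ?thesis by blast
  qed
  have "(\<lambda>x. generate G {x}) ` (carrier G - pth_powers)
      = (\<Union>b\<in>{..<a}. maximal_cyclic_of_order (p ^ Suc b))"
    using ord unfolding maximal_cyclic_of_order_def by blast
  moreover have "card (\<Union>b\<in>{..<a}. maximal_cyclic_of_order (p ^ Suc b))
      = (\<Sum>b<a. card (maximal_cyclic_of_order (p ^ Suc b)))"
  proof (rule card_UN_disjoint)
    have "card C = q" if "C \<in> maximal_cyclic_of_order q" for C q
      using that by (auto simp: maximal_cyclic_of_order_def simp flip: generate_pow_card)
    moreover have "p ^ Suc i \<noteq> p ^ Suc j" if "i \<noteq> j" for i j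
      using that p by (simp add: power_inject_exp del: power_Suc)
    ultimately have "maximal_cyclic_of_order (p ^ Suc i) \<inter> maximal_cyclic_of_order (p ^ Suc j) = {}"
      if "i \<noteq> j" for i j
      using that by (metis disjoint_iff)
    then show "\<forall>i\<in>{..<a}. \<forall>j\<in>{..<a}. i \<noteq> j \<longrightarrow>
        maximal_cyclic_of_order (p ^ Suc i) \<inter> maximal_cyclic_of_order (p ^ Suc j) = {}"
      by simp
  qed (use finite_carrier in \<open>auto simp: maximal_cyclic_of_order_def\<close>)
  ultimately show ?thesis
    unfolding independence_number_eq[OF assms(1)] card_maximal_cyclic_of_order[symmetric] by simp
qed

end

section \<open>Evaluation of the count\<close>

text \<open>The group has dropped out: what remains is an identity between sums in \<open>p\<close>,
  \<open>\<alpha>\<close> and \<open>m\<close>.\<close>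

locale abelian_type =
  fixes p s :: nat and \<alpha> m :: "nat \<Rightarrow> nat"
  assumes p_gt_1: "p > 1" and s_pos: "s \<ge> 1"
    and m_pos: "\<And>i. i \<in> {1..s} \<Longrightarrow> m i > 0"
    and \<alpha>_decreasing: "\<And>i j. 1 \<le> i \<Longrightarrow> i < j \<Longrightarrow> j \<le> s \<Longrightarrow> \<alpha> i > \<alpha> j"
begin

definition torsion_exponent :: "nat \<Rightarrow> nat" where
  "torsion_exponent b = (\<Sum>i=1..s. m i * min (\<alpha> i) b)"

text \<open>The ratio \<open>N b / p ^ b\<close> of the overview. Between consecutive values of
  \<open>\<alpha>\<close> it is a geometric sequence in \<open>b\<close>.\<close>

definition torsion_ratio :: "nat \<Rightarrow> real" where
  "torsion_ratio b = real p ^ torsion_exponent b / real p ^ b"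

abbreviation rank :: "nat \<Rightarrow> nat" where
  "rank \<equiv> partial_rank m"

abbreviation log_size :: "nat \<Rightarrow> nat" where
  "log_size j \<equiv> (\<Sum>i=1..j. m i * \<alpha> i)"

section \<open>Torsion ratios between consecutive exponents\<close>

lemma \<alpha>_antimono: "1 \<le> i \<Longrightarrow> i \<le> j \<Longrightarrow> j \<le> s \<Longrightarrow> \<alpha> j \<le> \<alpha> i"
  using \<alpha>_decreasing[of i j] by (cases "i = j") auto

lemma rank_mono: "i \<le> j \<Longrightarrow> rank i \<le> rank j"
  unfolding partial_rank_def by (intro sum_mono2) auto

lemma rank_pos: "1 \<le> j \<Longrightarrow> j \<le> s \<Longrightarrow> rank j \<ge> 1"
  using rank_mono[of 1 j] m_pos[of 1] by (simp add: partial_rank_def)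

text \<open>For \<open>b\<close> between \<open>\<alpha> (Suc j)\<close> and
  \<open>\<alpha> j\<close> the minimum is \<open>b\<close> in the first \<open>j\<close> blocks and
  \<open>\<alpha> i\<close> in the others. For \<open>j = s\<close> the lower bound is just
  \<open>0\<close>. The additive form avoids truncated subtraction.\<close>

lemma torsion_exponent_eq:
  assumes "1 \<le> j" "j \<le> s" "b \<le> \<alpha> j" "j < s \<Longrightarrow> \<alpha> (Suc j) \<le> b"
  shows "torsion_exponent b + log_size j = rank j * b + log_size s"
proof -
  have split: "(\<Sum>i=1..s. g i) = (\<Sum>i=1..j. g i) + (\<Sum>i=Suc j..s. g i)" for g :: "nat \<Rightarrow> nat"
  proof -
    have "{1..s} = {1..j} \<union> {Suc j..s}" using assms by auto
    then show ?thesis by (simp add: sum.union_disjoint)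
  qed
  have "(\<Sum>i=1..j. m i * min (\<alpha> i) b) = (\<Sum>i=1..j. m i * b)"
  proof (intro sum.cong refl)
    fix i assume "i \<in> {1..j}"
    then have "b \<le> \<alpha> i" using \<alpha>_antimono[of i j] assms by simp
    then show "m i * min (\<alpha> i) b = m i * b" by simp
  qed
  moreover have "(\<Sum>i=Suc j..s. m i * min (\<alpha> i) b) = (\<Sum>i=Suc j..s. m i * \<alpha> i)"
  proof (intro sum.cong refl)
    fix i assume "i \<in> {Suc j..s}"
    then have "\<alpha> i \<le> \<alpha> (Suc j)" "j < s" using \<alpha>_antimono[of "Suc j" i] by auto
    then show "m i * min (\<alpha> i) b = m i * \<alpha> i" using assms(4) by simp
  qed
  ultimately show ?thesis
    unfolding torsion_exponent_def partial_rank_def split[of "\<lambda>i. m i * min (\<alpha> i) b"]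
      split[of "\<lambda>i. m i * \<alpha> i"]
    by (simp add: sum_distrib_right)
qed

text \<open>Identifies the terms of the claimed formula as torsion ratios:
  \<open>b = \<alpha> k\<close> gives the leading term of the braces, and \<open>b = \<beta>\<close>
  the inner terms of the correction.\<close>

lemma torsion_ratio_eq:
  assumes "1 \<le> j" "j \<le> s" "b \<le> \<alpha> j" "j < s \<Longrightarrow> \<alpha> (Suc j) \<le> b"
  shows "real (partial_size p \<alpha> m s) * (real p ^ ((rank j - 1) * b) / real (partial_size p \<alpha> m j))
    = torsion_ratio b"
proof -
  obtain q where q: "rank j = Suc q" using rank_pos[OF assms(1,2)] by (cases "rank j") auto
  have "real p ^ log_size s * real p ^ (q * b) * real p ^ b
      = real p ^ torsion_exponent b * real p ^ log_size j"
    using torsion_exponent_eq[OF assms] unfolding q by (simp add: algebra_simps flip: power_add)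
  then show ?thesis
    using p_gt_1 by (simp add: torsion_ratio_def partial_size_def q field_simps)
qed

lemma torsion_ratio_Suc:
  assumes "1 \<le> j" "j \<le> s" "b < \<alpha> j" "j < s \<Longrightarrow> \<alpha> (Suc j) \<le> b"
  shows "real p * torsion_ratio (Suc b) = real p ^ rank j * torsion_ratio b"
proof -
  have "torsion_exponent (Suc b) + log_size j = rank j * Suc b + log_size s"
    using assms by (intro torsion_exponent_eq) auto
  moreover have "torsion_exponent b + log_size j = rank j * b + log_size s"
    using assms by (intro torsion_exponent_eq) auto
  ultimately have "torsion_exponent (Suc b) = rank j + torsion_exponent b"
    by simp
  then show ?thesis using p_gt_1 by (simp add: torsion_ratio_def power_add)
qed

lemma torsion_exponent_ge: "\<alpha> 1 \<le> b \<Longrightarrow> torsion_exponent b = log_size s"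
  unfolding torsion_exponent_def using \<alpha>_antimono[of 1]
  by (intro sum.cong) (auto simp: min_def dest: order_trans)

text \<open>Each term is \<open>(c - 1) * g (Suc i)\<close> plus the difference
  \<open>g (Suc i) - g i\<close>. It serves with \<open>c = p\<close>, and with \<open>c = 1\<close>
  to shift an index.\<close>

lemma sum_telescope:
  fixes g :: "nat \<Rightarrow> real"
  assumes "a \<le> b"
  shows "(\<Sum>i=a..<b. c * g (Suc i) - g i) = (c - 1) * (\<Sum>i=a..<b. g (Suc i)) + g b - g a"
  using assms by (induction b rule: dec_induct) (simp_all add: algebra_simps)

section \<open>Summation of the claimed formula over blocks\<close>

lemma sum_power_block:
  assumes "a \<le> b"
  shows "(\<Sum>t=Suc a..b. 1 / real p ^ (t - 1))
    = real p / (real p - 1) * (1 / real p ^ a - 1 / real p ^ b)"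
  using assms
proof (induction b rule: dec_induct)
  case (step n)
  let ?c = "real p / (real p - 1)"
  have "1 / real p ^ n = ?c * (1 / real p ^ n - 1 / real p ^ Suc n)"
    using p_gt_1 by (simp add: field_simps)
  moreover have "(\<Sum>t=Suc a..Suc n. 1 / real p ^ (t - 1))
      = (\<Sum>t=Suc a..n. 1 / real p ^ (t - 1)) + 1 / real p ^ n"
    using step by simp
  ultimately have "(\<Sum>t=Suc a..Suc n. 1 / real p ^ (t - 1))
      = ?c * (1 / real p ^ a - 1 / real p ^ n) + ?c * (1 / real p ^ n - 1 / real p ^ Suc n)"
    using step.IH by presburger
  then show ?case by (simp only: flip: distrib_left) simp
qed simp

text \<open>The braces of the formula multiplied by \<open>n\<close>, so that the summand at
  \<open>t\<close> is \<open>bracket k / p ^ (t - 1)\<close>.\<close>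

definition bracket :: "nat \<Rightarrow> real" where
  "bracket k = real (partial_size p \<alpha> m s)
    * (real p ^ ((rank k - 1) * \<alpha> k) / real (partial_size p \<alpha> m k) + correction_term p \<alpha> m k)"

lemma bracket_1: "bracket 1 = torsion_ratio (\<alpha> 1)"
  using torsion_ratio_eq[of 1 "\<alpha> 1"] s_pos \<alpha>_antimono[of 1 "Suc 1"]
  by (simp add: bracket_def correction_term_def)

text \<open>The new part of the correction term telescopes to the stated sum plus
  \<open>torsion_ratio (\<alpha> k) - torsion_ratio (\<alpha> (Suc k))\<close>, and this difference
  cancels against the change of the leading term.\<close>

lemma bracket_Suc:
  assumes "1 \<le> k" "k < s"
  shows "bracket (Suc k)
    = bracket k + (real p - 1) * (\<Sum>b=\<alpha> (Suc k)..<\<alpha> k. torsion_ratio (Suc b))"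
proof -
  let ?n = "real (partial_size p \<alpha> m s)"
  have lt: "\<alpha> (Suc k) < \<alpha> k" using \<alpha>_decreasing assms by simp
  have fk: "?n * (real p ^ ((rank k - 1) * \<alpha> k) / real (partial_size p \<alpha> m k))
      = torsion_ratio (\<alpha> k)"
    using assms lt by (intro torsion_ratio_eq) auto
  have fSk: "?n * (real p ^ ((rank (Suc k) - 1) * \<alpha> (Suc k)) / real (partial_size p \<alpha> m (Suc k)))
      = torsion_ratio (\<alpha> (Suc k))"
    using assms \<alpha>_antimono[of "Suc k" "Suc (Suc k)"] by (intro torsion_ratio_eq) auto
  have interval: "{\<alpha> (Suc k)..\<alpha> k - 1} = {\<alpha> (Suc k)..<\<alpha> k}" using lt by auto
  have corr: "correction_term p \<alpha> m (Suc k) = correction_term p \<alpha> m k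
      + (real p ^ rank k - 1) / real (partial_size p \<alpha> m k)
        * (\<Sum>b=\<alpha> (Suc k)..<\<alpha> k. real p ^ ((rank k - 1) * b))"
    using assms(1) interval by (cases k) (auto simp: correction_term_def)
  have "?n * ((real p ^ rank k - 1) / real (partial_size p \<alpha> m k)
        * (\<Sum>b=\<alpha> (Suc k)..<\<alpha> k. real p ^ ((rank k - 1) * b)))
      = (\<Sum>b=\<alpha> (Suc k)..<\<alpha> k. (real p ^ rank k - 1)
          * (?n * (real p ^ ((rank k - 1) * b) / real (partial_size p \<alpha> m k))))"
    by (simp add: sum_distrib_left mult_ac)
  also have "\<dots> = (\<Sum>b=\<alpha> (Suc k)..<\<alpha> k. real p * torsion_ratio (Suc b) - torsion_ratio b)"
  proof (intro sum.cong refl)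
    fix b assume b: "b \<in> {\<alpha> (Suc k)..<\<alpha> k}"
    have "?n * (real p ^ ((rank k - 1) * b) / real (partial_size p \<alpha> m k)) = torsion_ratio b"
      using assms b by (intro torsion_ratio_eq) auto
    moreover have "real p * torsion_ratio (Suc b) = real p ^ rank k * torsion_ratio b"
      using assms b by (intro torsion_ratio_Suc) auto
    ultimately show "(real p ^ rank k - 1)
        * (?n * (real p ^ ((rank k - 1) * b) / real (partial_size p \<alpha> m k)))
        = real p * torsion_ratio (Suc b) - torsion_ratio b"
      by (simp add: algebra_simps)
  qed
  also have "\<dots> = (real p - 1) * (\<Sum>b=\<alpha> (Suc k)..<\<alpha> k. torsion_ratio (Suc b))
      + torsion_ratio (\<alpha> k) - torsion_ratio (\<alpha> (Suc k))"
    using lt by (intro sum_telescope) simp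
  finally show ?thesis
    unfolding bracket_def corr distrib_left fk fSk by simp
qed

lemma sum_intervals_\<alpha>:
  assumes "1 \<le> k" "k < s"
  shows "(\<Sum>b=\<alpha> (Suc k)..<\<alpha> 1. g b) = (\<Sum>b=\<alpha> (Suc k)..<\<alpha> k. g b) + (\<Sum>b=\<alpha> k..<\<alpha> 1. g b :: real)"
  using assms \<alpha>_antimono[of k "Suc k"] \<alpha>_antimono[of 1 k] by (simp add: sum.atLeastLessThan_concat)

lemma bracket_eq:
  assumes "1 \<le> k" "k \<le> s"
  shows "bracket k = torsion_ratio (\<alpha> 1) + (real p - 1) * (\<Sum>b=\<alpha> k..<\<alpha> 1. torsion_ratio (Suc b))"
  using assms
proof (induction k rule: dec_induct)
  case base
  then show ?case by (simp add: bracket_1[simplified])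
next
  case (step k)
  then have "bracket (Suc k) = torsion_ratio (\<alpha> 1)
      + (real p - 1) * (\<Sum>b=\<alpha> k..<\<alpha> 1. torsion_ratio (Suc b))
      + (real p - 1) * (\<Sum>b=\<alpha> (Suc k)..<\<alpha> k. torsion_ratio (Suc b))"
    using bracket_Suc[of k] by simp
  moreover have "1 \<le> k" "k < s" using step by simp_all
  ultimately show ?case by (simp only: sum_intervals_\<alpha> distrib_left add_ac)
qed

text \<open>Monotonicity of \<open>rank\<close> makes the blocks disjoint, so the definite
  description has a unique solution.\<close>

lemma block_index_eq:
  assumes "1 \<le> k" "k \<le> s" "rank (k - 1) < t" "t \<le> rank k"
  shows "block_index s m t = k"
  unfolding block_index_def
proof (rule the_equality)
  fix l assume l: "l \<in> {1..s} \<and> rank (l - 1) < t \<and> t \<le> rank l"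
  show "l = k"
  proof (rule linorder_cases[of l k])
    assume "l < k"
    then have "l \<le> k - 1" by simp
    then show ?thesis using l assms rank_mono[of l "k - 1"] by simp
  next
    assume "k < l"
    then have "k \<le> l - 1" by simp
    then show ?thesis using l assms rank_mono[of k "l - 1"] by simp
  qed
qed (use assms in auto)

text \<open>Summation by parts: each block contributes a difference of powers of
  \<open>1 / p\<close> times a constant bracket, and shifting the differences onto the brackets
  makes \<open>bracket_Suc\<close> applicable.\<close>

lemma sum_bracket_eq:
  assumes "1 \<le> k" "k \<le> s"
  shows "(\<Sum>t=1..rank k. 1 / real p ^ (t - 1) * bracket (block_index s m t))
    = real p / (real p - 1) * (torsion_ratio (\<alpha> 1) - bracket k / real p ^ rank k)
      + (\<Sum>b=\<alpha> k..<\<alpha> 1. torsion_ratio b)"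
proof -
  let ?c = "real p / (real p - 1)"
  have block: "(\<Sum>t=Suc (rank (k - 1))..rank k. 1 / real p ^ (t - 1) * bracket (block_index s m t))
      = ?c * (1 / real p ^ rank (k - 1) - 1 / real p ^ rank k) * bracket k" if "1 \<le> k" "k \<le> s" for k
  proof -
    have "(\<Sum>t=Suc (rank (k - 1))..rank k. 1 / real p ^ (t - 1) * bracket (block_index s m t))
        = (\<Sum>t=Suc (rank (k - 1))..rank k. 1 / real p ^ (t - 1)) * bracket k"
      unfolding sum_distrib_right using that by (intro sum.cong) (auto simp: block_index_eq)
    then show ?thesis using sum_power_block[OF rank_mono[of "k - 1" k]] by simp
  qed
  show ?thesis
    using assms
  proof (induction k rule: dec_induct)
    case base
    then show ?case
      using block[of 1] s_pos bracket_1 by (simp add: partial_rank_def algebra_simps)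
  next
    case (step k)
    have "{1..rank (Suc k)} = {1..rank k} \<union> {Suc (rank k)..rank (Suc k)}"
      using rank_mono[of k "Suc k"] by auto
    then have "(\<Sum>t=1..rank (Suc k). 1 / real p ^ (t - 1) * bracket (block_index s m t))
      = (\<Sum>t=1..rank k. 1 / real p ^ (t - 1) * bracket (block_index s m t))
        + (\<Sum>t=Suc (rank k)..rank (Suc k). 1 / real p ^ (t - 1) * bracket (block_index s m t))"
      by (simp add: sum.union_disjoint)
    also have "\<dots> = ?c * (torsion_ratio (\<alpha> 1) - bracket k / real p ^ rank k)
      + (\<Sum>b=\<alpha> k..<\<alpha> 1. torsion_ratio b)
        + ?c * (1 / real p ^ rank k - 1 / real p ^ rank (Suc k)) * bracket (Suc k)"
      using step block[of "Suc k"] by simp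
    also have "\<dots> = ?c * (torsion_ratio (\<alpha> 1) - bracket (Suc k) / real p ^ rank (Suc k))
        + ?c * (bracket (Suc k) - bracket k) / real p ^ rank k + (\<Sum>b=\<alpha> k..<\<alpha> 1. torsion_ratio b)"
      by (simp add: algebra_simps diff_divide_distrib)
    also have "?c * (bracket (Suc k) - bracket k) / real p ^ rank k
        = (\<Sum>b=\<alpha> (Suc k)..<\<alpha> k. real p * torsion_ratio (Suc b) / real p ^ rank k)"
      using step p_gt_1 bracket_Suc[of k]
      by (simp add: sum_distrib_left sum_divide_distrib)
    \<comment> \<open>The weight \<open>1 / p ^ rank k\<close> is exactly the inverse of the growth
      factor on this interval, so the shift from \<open>b\<close> to \<open>Suc b\<close> is
      undone.\<close>
    also have "\<dots> = (\<Sum>b=\<alpha> (Suc k)..<\<alpha> k. torsion_ratio b)"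
      using step p_gt_1 by (intro sum.cong) (auto simp: torsion_ratio_Suc[of k])
    finally show ?case using step sum_intervals_\<alpha>[of k torsion_ratio] by simp
  qed
qed

lemma count_eq:
  fixes N :: "nat \<Rightarrow> nat"
  assumes "\<And>b. N b = p ^ torsion_exponent b" and "\<alpha> s > 0"
  shows "(\<Sum>b<\<alpha> 1. ((real (N (Suc b)) - real (N b))
      - (real (N (Suc (Suc b))) - real (N (Suc b))) / real (N 1)) / (real p ^ b * (real p - 1)))
    = (\<Sum>t=1..rank s. 1 / real p ^ (t - 1) * bracket (block_index s m t))"
proof -
  let ?P = "real p ^ rank s" and ?c = "real p / (real p - 1)"
  \<comment> \<open>In terms of torsion counts this is
    \<open>(N b - N (Suc b) / N 1) / p ^ b\<close>, the number of elements of the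
    \<open>p ^ b\<close>-torsion that are not \<open>p\<close>-th powers, divided by
    \<open>p ^ b\<close>.\<close>
  define h where "h b = torsion_ratio b - real p * torsion_ratio (Suc b) / ?P" for b
  have p: "real p > 1" using p_gt_1 by simp
  have N: "real (N b) = torsion_ratio b * real p ^ b" for b
    using p by (simp add: assms torsion_ratio_def)
  have h_0: "h b = 0" if "b < \<alpha> s" for b
    using torsion_ratio_Suc[of s b] that s_pos p by (simp add: h_def)
  have f0: "torsion_ratio 0 = 1" by (simp add: torsion_ratio_def torsion_exponent_def)
  \<comment> \<open>\<open>h 0 = 0\<close>, available because \<open>\<alpha> s > 0\<close>, says
    that \<open>p * torsion_ratio 1\<close>, which is \<open>N 1\<close>, equals
    \<open>?P\<close>.\<close>
  have N1: "real (N 1) = ?P"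
    using h_0[of 0] assms(2) f0 p N[of 1] by (simp add: h_def field_simps)
  have "(\<Sum>b<\<alpha> 1. ((real (N (Suc b)) - real (N b))
      - (real (N (Suc (Suc b))) - real (N (Suc b))) / real (N 1)) / (real p ^ b * (real p - 1)))
    = (\<Sum>b<\<alpha> 1. (real p * h (Suc b) - h b) / (real p - 1))"
    unfolding N1 unfolding N h_def using p by (intro sum.cong) (simp_all add: field_simps)
  also have "\<dots> = (\<Sum>b=0..<\<alpha> 1. real p * h (Suc b) - h b) / (real p - 1)"
    by (simp add: sum_divide_distrib lessThan_atLeast0)
  also have "\<dots> = (real p * h (\<alpha> 1) + (real p - 1) * (\<Sum>b=0..<\<alpha> 1. h b)) / (real p - 1)"
  proof -
    have "(\<Sum>b=0..<\<alpha> 1. h (Suc b)) = (\<Sum>b=0..<\<alpha> 1. h b) + h (\<alpha> 1) - h 0"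
      using sum_telescope[of 0 "\<alpha> 1" 1 h] by (simp add: sum_subtractf)
    then show ?thesis
      using sum_telescope[of 0 "\<alpha> 1" "real p" h] h_0[of 0] assms(2) by (simp add: algebra_simps)
  qed
  also have "\<dots> = ?c * h (\<alpha> 1) + (\<Sum>b=0..<\<alpha> 1. h b)"
    using p by (simp add: add_divide_distrib)
  \<comment> \<open>From \<open>\<alpha> 1\<close> on the torsion is the whole group, so the factor
    \<open>p\<close> cancels the larger denominator of the next ratio.\<close>
  also have "h (\<alpha> 1) = torsion_ratio (\<alpha> 1) - torsion_ratio (\<alpha> 1) / ?P"
    using p by (simp add: h_def torsion_ratio_def torsion_exponent_ge)
  also have "(\<Sum>b=0..<\<alpha> 1. h b) = (\<Sum>b=\<alpha> s..<\<alpha> 1. h b)"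
    using h_0 by (intro sum.mono_neutral_right) auto
  also have "\<dots> = (\<Sum>b=\<alpha> s..<\<alpha> 1. torsion_ratio b)
      - real p / ?P * (\<Sum>b=\<alpha> s..<\<alpha> 1. torsion_ratio (Suc b))"
    by (simp add: h_def sum_subtractf sum_distrib_left)
  \<comment> \<open>Since \<open>?c * (p - 1) = p\<close>, the sum of shifted ratios is precisely
    the part by which \<open>bracket s\<close> exceeds
    \<open>torsion_ratio (\<alpha> 1)\<close>.\<close>
  also have "?c * (torsion_ratio (\<alpha> 1) - torsion_ratio (\<alpha> 1) / ?P) + \<dots>
      = ?c * (torsion_ratio (\<alpha> 1) - bracket s / ?P) + (\<Sum>b=\<alpha> s..<\<alpha> 1. torsion_ratio b)"
    using p s_pos by (simp add: bracket_eq field_simps)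
  also have "\<dots> = (\<Sum>t=1..rank s. 1 / real p ^ (t - 1) * bracket (block_index s m t))"
    using sum_bracket_eq[of s] s_pos by simp
  finally show ?thesis .
qed

end

theorem theorem3p10:
  fixes G :: "('a, 'b) monoid_scheme"
    and p s :: nat
    and \<alpha> m :: "nat \<Rightarrow> nat"
  assumes "prime p"
    and "s \<ge> 1"
    and "\<And>i. i \<in> {1..s} \<Longrightarrow> \<alpha> i > 0"
    and "\<And>i. i \<in> {1..s} \<Longrightarrow> m i > 0"
    and "\<And>i j. 1 \<le> i \<Longrightarrow> i < j \<Longrightarrow> j \<le> s \<Longrightarrow> \<alpha> i > \<alpha> j"
    and "comm_group G"
    and "finite (carrier G)"
    and "\<exists>e. order G = p ^ e"
    and "G \<cong> abelian_type_group p s \<alpha> m"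
  shows "real (independence_number (power_graph G)) =
    (\<Sum>t=1..partial_rank m s.
       let k = block_index s m t in
         real (partial_size p \<alpha> m s) / real p ^ (t - 1) *
         (real p ^ ((partial_rank m k - 1) * \<alpha> k) / real (partial_size p \<alpha> m k)
          + correction_term p \<alpha> m k))"
proof -
  obtain e where e: "order G = p ^ e" using assms(8) by blast
  interpret P: finite_abelian_p_group G p e
    using assms e by (simp add: finite_abelian_p_group_def finite_abelian_p_group_axioms_def)
  interpret T: abelian_type p s \<alpha> m
    using assms(1,2,4,5) by unfold_locales (auto simp: prime_gt_1_nat prime_gt_Suc_0_nat)
  have group: "group (abelian_type_group p s \<alpha> m)"
    by (simp add: abelian_type_group_def cyclic_power_def)
  have card_T: "P.torsion_card b = p ^ T.torsion_exponent b" for b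
    using card_power_torsion_iso[OF assms(9) P.is_group group]
    by (simp add: card_power_torsion_abelian_type_group[OF assms(1)] T.torsion_exponent_def)
  \<comment> \<open>The exponent \<open>max e (\<alpha> 1)\<close> kills all of \<open>G\<close>
    because \<open>p ^ e\<close> is its order, while the torsion count is already constant from
    \<open>\<alpha> 1\<close> on.\<close>
  have "power_torsion G (p ^ \<alpha> 1) = power_torsion G (p ^ max e (\<alpha> 1))"
  proof (rule card_subset_eq)
    have "p ^ \<alpha> 1 dvd p ^ max e (\<alpha> 1)" by (simp add: le_imp_power_dvd)
    then show "power_torsion G (p ^ \<alpha> 1) \<subseteq> power_torsion G (p ^ max e (\<alpha> 1))"
      unfolding subset_iff P.mem_power_torsion_iff using dvd_trans by blast
  qed (simp_all add: P.finite_power_torsion card_T T.torsion_exponent_ge)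
  also have "\<dots> = carrier G"
  proof -
    have "p ^ e dvd p ^ max e (\<alpha> 1)" by (simp add: le_imp_power_dvd)
    then have "P.ord x dvd p ^ max e (\<alpha> 1)" if "x \<in> carrier G" for x
      using P.ord_dvd_group_order[OF that] e dvd_trans by metis
    then show ?thesis by (auto simp: P.mem_power_torsion_iff)
  qed
  finally have full: "power_torsion G (p ^ \<alpha> 1) = carrier G" .
  have "e > 0"
  proof (rule ccontr)
    assume "\<not> e > 0"
    then have "card (carrier G) = 1" using e by (simp add: order_def)
    moreover have "card (carrier G) = p ^ T.torsion_exponent (\<alpha> 1)" using full card_T by metis
    moreover have "T.torsion_exponent (\<alpha> 1) > 0"
      using assms(2,3,4) by (auto simp: T.torsion_exponent_def intro!: sum_pos)
    ultimately show False using T.p_gt_1 by simp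
  qed
  then have "real (independence_number (power_graph G))
      = (\<Sum>t=1..T.rank s. 1 / real p ^ (t - 1) * T.bracket (block_index s m t))"
    using P.independence_number_eq_sum[OF _ full] T.count_eq[OF card_T] assms(2,3) by simp
  then show ?thesis
    by (simp add: T.bracket_def Let_def)
qed

end
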